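(* The following holds. (i) If $F_t(q_{it},q_{-it})-F_t(x_i,q_{-it})=P_{it}(q_{it},q_{-it})-P_{it}(x_i,q_{-it})$ for all $q_t\in\mathbb{R}^{I}$, $x_i\in\mathbb{R}$, $t=1,\dots,T$ and $i=1,\dots,I$, then every optimal solution to the system-wide problem (SW) is a unit commitment constrained Nash equilibrium. (ii) Assume further that the revenue differences do not depend on the other producers' quantities, i.e. there are functions $\tilde P_{it}:\mathbb{R}\to\mathbb{R}$ such that $P_{it}(q_{it},q_{-it})-P_{it}(\bar q_{it},q_{-it})=\tilde P_{it}(q_{it})-\tilde P_{it}(\bar q_{it})$ for all $q_{it},\bar q_{it}\in\mathbb{R}$, $q_{-it}\in\mathbb{R}^{I-1}$, $t=1,\dots,T$, $i=1,\dots,I$. If $F_t(q_t)-F_t(x)=\sum_{i=1}^I(\tilde P_{it}(q_{it})-\tilde P_{it}(x_i))$ for all $q_t\in\mathbb{R}^{I}$, $x\in\mathbb{R}^I$ and $t=1,\dots,T$, then every unit commitment constrained Nash equilibrium is an optimal solution to the system-wide problem (SW).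
   Context: Let $I,T,m,n$ be positive integers. There are $I$ producers, each operating one unit $i=1,\dots,I$ over time periods $t=1,\dots,T$. Producer $i$ chooses $q_i=(q_{i1},\dots,q_{iT})^\top\in\mathbb{R}^T$ and $u_i=(u_{i1},\dots,u_{iT})^\top\in\{0,1\}^T$. Write $q_t=(q_{1t},\dots,q_{It})^\top$, $q_{-it}=(q_{kt})_{k\neq i}$, $q_{-i}=(q_k)_{k\ne i}$; for a function of $q_t\in\mathbb{R}^I$, $(x_i,q_{-it})$ denotes $q_t$ with its $i$-th component replaced by $x_i$. Each $P_{it}:\mathbb{R}\times\mathbb{R}^{I-1}\to\mathbb{R}$ is a revenue function, concave and continuously differentiable in its first argument. For each $i$, $C_i:\mathbb{R}\to\mathbb{R}$ is convex and continuously differentiable, $S_i:\mathbb{R}^T\to\mathbb{R}$ is continuous, $A_i\in\mathbb{R}^{n\times T}$, $b_i\in\mathbb{R}^n$, $G_i,H_i\in\mathbb{R}^{m\times T}$, $h_i\in\mathbb{R}^m$. $(q_1,u_1,\dots,q_I,u_I)$ is a unit commitment constrained Nash equilibrium if for every $i=1,\dots,I$, given $q_{-i}$, the pair $(q_i,u_i)$ is an optimal solution to $$\max_{q_i,u_i}\Big\{\sum_{t=1}^TP_{it}(q_{it},q_{-it})-\sum_{t=1}^TC_i(q_{it})-S_i(u_i) : G_iq_i+H_iu_i\leq h_i,\ A_iu_i\leq b_i,\ u_i\in\{0,1\}^T\Big\}.$$ The system-wide problem (SW) is $$\max_{q,u}\Big\{\sum_{t=1}^TF_t(q_t)-\sum_{i=1}^I\sum_{t=1}^TC_i(q_{it})-\sum_{i=1}^IS_i(u_i)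 : G_iq_i+H_iu_i\leq h_i,\ A_iu_i\leq b_i,\ u_i\in\{0,1\}^T,\ i=1,\dots,I\Big\},$$ where each $F_t:\mathbb{R}^I\to\mathbb{R}$ is concave and continuously differentiable. *)

theory Defs
  imports "HOL-Analysis.Analysis"
begin

text \<open>
  Producers, time periods and the rows of the two constraint systems are indexed by finite types
  \<^typ>\<open>'i\<close>, \<^typ>\<open>'t\<close>, \<^typ>\<open>'m\<close>, \<^typ>\<open>'n\<close>. A profile is a function \<open>q :: 'i \<Rightarrow> real^'t\<close>;
  \<open>q i\<close> is the schedule of producer \<open>i\<close> and \<open>period q t\<close> the vector of all producers' values in
  period \<open>t\<close>.
\<close>

definition period :: "('i \<Rightarrow> real^'t) \<Rightarrow> 't \<Rightarrow> real^'i" where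
  "period q t = (\<chi> i. q i $ t)"

definition replace :: "real^'i \<Rightarrow> 'i \<Rightarrow> real \<Rightarrow> real^'i" where
  "replace y i x = (\<chi> k. if k = i then x else y $ k)"

text \<open>\<^const>\<open>C1_differentiable_on\<close> covers only functions of one real variable.\<close>

definition continuously_differentiable :: "('a::real_normed_vector \<Rightarrow> real) \<Rightarrow> bool" where
  "continuously_differentiable f \<longleftrightarrow>
    (\<exists>f' :: 'a \<Rightarrow> 'a \<Rightarrow>\<^sub>L real.
      (\<forall>x. (f has_derivative blinfun_apply (f' x)) (at x)) \<and> continuous_on UNIV f')"

text \<open>
  The pair \<open>(x, v)\<close> is the schedule \<open>(q\<^sub>i, u\<^sub>i)\<close> of a single producer. The order on \<open>real^'m\<close> and
  \<open>real^'n\<close> is componentwise.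
\<close>

definition unit_feasible ::
  "real^'t^'m \<Rightarrow> real^'t^'m \<Rightarrow> real^'m \<Rightarrow> real^'t^'n \<Rightarrow> real^'n \<Rightarrow> real^'t \<Rightarrow> real^'t \<Rightarrow> bool" where
  "unit_feasible G H h A b x v \<longleftrightarrow>
    G *v x + H *v v \<le> h \<and> A *v v \<le> b \<and> (\<forall>t. v $ t \<in> {0, 1})"

text \<open>
  A revenue function of the pair \<open>(q\<^sub>i\<^sub>t, q\<^sub>-\<^sub>i\<^sub>t)\<close> is given as a function \<open>P i t\<close> of the full vector in
  \<open>real^'i\<close>, the first argument being the component \<open>i\<close>. Hence \<open>P i t (replace (period q t) i x)\<close>
  does not involve the quantity of producer \<open>i\<close> in \<open>q\<close>, and only the quantities of the others are
  held fixed in the problem of producer \<open>i\<close>.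
\<close>

definition producer_profit ::
  "('i \<Rightarrow> 't \<Rightarrow> real^'i \<Rightarrow> real) \<Rightarrow> ('i \<Rightarrow> real \<Rightarrow> real) \<Rightarrow> ('i \<Rightarrow> real^'t \<Rightarrow> real) \<Rightarrow>
    'i \<Rightarrow> ('i \<Rightarrow> real^'t) \<Rightarrow> real^'t \<Rightarrow> real^'t \<Rightarrow> real" where
  "producer_profit P C S i q x v =
    (\<Sum>t\<in>UNIV. P i t (replace (period q t) i (x $ t))) - (\<Sum>t\<in>UNIV. C i (x $ t)) - S i v"

definition uc_nash_equilibrium ::
  "('i \<Rightarrow> 't \<Rightarrow> real^'i \<Rightarrow> real) \<Rightarrow> ('i \<Rightarrow> real \<Rightarrow> real) \<Rightarrow> ('i \<Rightarrow> real^'t \<Rightarrow> real) \<Rightarrow>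
    ('i \<Rightarrow> real^'t^'m) \<Rightarrow> ('i \<Rightarrow> real^'t^'m) \<Rightarrow> ('i \<Rightarrow> real^'m) \<Rightarrow>
    ('i \<Rightarrow> real^'t^'n) \<Rightarrow> ('i \<Rightarrow> real^'n) \<Rightarrow> ('i \<Rightarrow> real^'t) \<Rightarrow> ('i \<Rightarrow> real^'t) \<Rightarrow> bool" where
  "uc_nash_equilibrium P C S G H h A b q u \<longleftrightarrow>
    (\<forall>i. is_arg_max (\<lambda>(x, v). producer_profit P C S i q x v)
          (\<lambda>(x, v). unit_feasible (G i) (H i) (h i) (A i) (b i) x v) (q i, u i))"

definition system_welfare ::
  "('t \<Rightarrow> real^'i \<Rightarrow> real) \<Rightarrow> ('i \<Rightarrow> real \<Rightarrow> real) \<Rightarrow> ('i \<Rightarrow> real^'t \<Rightarrow> real) \<Rightarrow>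
    ('i \<Rightarrow> real^'t) \<Rightarrow> ('i \<Rightarrow> real^'t) \<Rightarrow> real" where
  "system_welfare F C S q u =
    (\<Sum>t\<in>UNIV. F t (period q t)) - (\<Sum>i\<in>UNIV. \<Sum>t\<in>UNIV. C i (q i $ t)) - (\<Sum>i\<in>UNIV. S i (u i))"

definition system_optimal ::
  "('t \<Rightarrow> real^'i \<Rightarrow> real) \<Rightarrow> ('i \<Rightarrow> real \<Rightarrow> real) \<Rightarrow> ('i \<Rightarrow> real^'t \<Rightarrow> real) \<Rightarrow>
    ('i \<Rightarrow> real^'t^'m) \<Rightarrow> ('i \<Rightarrow> real^'t^'m) \<Rightarrow> ('i \<Rightarrow> real^'m) \<Rightarrow>
    ('i \<Rightarrow> real^'t^'n) \<Rightarrow> ('i \<Rightarrow> real^'n) \<Rightarrow> ('i \<Rightarrow> real^'t) \<Rightarrow> ('i \<Rightarrow> real^'t) \<Rightarrow> bool" where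
  "system_optimal F C S G H h A b q u \<longleftrightarrow>
    is_arg_max (\<lambda>(q, u). system_welfare F C S q u)
      (\<lambda>(q, u). \<forall>i. unit_feasible (G i) (H i) (h i) (A i) (b i) (q i) (u i)) (q, u)"

end

theory Submission
  imports Defs
begin

text \<open>
  In both parts the system-wide objective is a potential for the game. Under the hypothesis of (i),
  a deviation of one producer changes it by exactly the change of that producer's profit, so
  an improving deviation would improve the system-wide optimum. Under the hypothesis of (ii),
  passing to an arbitrary other profile changes it by the sum of the profit changes of the individual
  unilateral deviations, none of which is positive at an equilibrium.
\<close>

lemma period_fun_upd: "period (q(i := x)) t = replace (period q t) i (x $ t)"
  by (simp add: period_def replace_def vec_eq_iff)

lemma replace_period_self: "replace (period q t) i (q i $ t) = period q t"
  by (simp add: period_def replace_def vec_eq_iff)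

text \<open>All summands away from \<open>i\<close> cancel. This isolates the deviating producer's
  share in the cost sum and in the \<open>S\<close> sum of the welfare.\<close>

lemma sum_fun_upd_diff:
  fixes f :: "'a::finite \<Rightarrow> 'b \<Rightarrow> real"
  shows "(\<Sum>k\<in>UNIV. f k ((g(i := y)) k)) - (\<Sum>k\<in>UNIV. f k (g k)) = f i y - f i (g i)"
proof -
  have "(\<Sum>k\<in>UNIV. f k ((g(i := y)) k)) - (\<Sum>k\<in>UNIV. f k (g k))
      = (\<Sum>k\<in>UNIV. if k = i then f i y - f i (g i) else 0)"
    unfolding sum_subtractf [symmetric] by (rule sum.cong) auto
  then show ?thesis by simp
qed

lemma system_welfare_unilateral_diff:
  fixes P :: "'i::finite \<Rightarrow> 't::finite \<Rightarrow> real^'i \<Rightarrow> real"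
  assumes "\<And>i t y x. F t y - F t (replace y i x) = P i t y - P i t (replace y i x)"
  shows "system_welfare F C S (q(i := x)) (u(i := v)) - system_welfare F C S q u
    = producer_profit P C S i q x v - producer_profit P C S i q (q i) (u i)"
proof -
  have "(\<Sum>t\<in>UNIV. F t (period (q(i := x)) t)) - (\<Sum>t\<in>UNIV. F t (period q t))
      = (\<Sum>t\<in>UNIV. P i t (replace (period q t) i (x $ t))) - (\<Sum>t\<in>UNIV. P i t (period q t))"
    unfolding sum_subtractf [symmetric]
  proof (rule sum.cong)
    fix t
    show "F t (period (q(i := x)) t) - F t (period q t)
        = P i t (replace (period q t) i (x $ t)) - P i t (period q t)"
      \<comment> \<open>The hypothesis compares old minus new values, so the claim is its negation,
        taken at the current quantities of the period.\<close>
      using assms [of t "period q t" i "x $ t"] by (simp add: period_fun_upd)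
  qed simp
  \<comment> \<open>Summing the cost over all periods makes it a function of a producer's whole
    schedule, so the double sum also reduces to producer \<open>i\<close>.\<close>
  moreover note sum_fun_upd_diff [of "\<lambda>k y. \<Sum>t\<in>UNIV. C k (y $ t)" q i x]
    and sum_fun_upd_diff [of S u i v]
  ultimately show ?thesis
    by (simp add: system_welfare_def producer_profit_def replace_period_self)
qed

text \<open>All producers move at once on the left, yet every profit on the right keeps the others
  at the old \<open>q\<close>. This is possible because revenue differences do not see the others'
  quantities.\<close>

lemma system_welfare_separable_diff:
  fixes P :: "'i::finite \<Rightarrow> 't::finite \<Rightarrow> real^'i \<Rightarrow> real"
  assumes P: "\<And>i t y x x'. P i t (replace y i x) - P i t (replace y i x') = Pt i t x - Pt i t x'"
    and F: "\<And>t y x. F t y - F t x = (\<Sum>i\<in>UNIV. Pt i t (y $ i) - Pt i t (x $ i))"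
  shows "system_welfare F C S q' u' - system_welfare F C S q u
    = (\<Sum>i\<in>UNIV. producer_profit P C S i q (q' i) (u' i) - producer_profit P C S i q (q i) (u i))"
proof -
  have "(\<Sum>t\<in>UNIV. F t (period q' t)) - (\<Sum>t\<in>UNIV. F t (period q t))
      = (\<Sum>t\<in>UNIV. \<Sum>i\<in>UNIV. Pt i t (q' i $ t) - Pt i t (q i $ t))"
    unfolding sum_subtractf [symmetric] F by (simp add: period_def sum_subtractf)
  \<comment> \<open>Welfare is grouped by period, profits by producer.\<close>
  also have "\<dots> = (\<Sum>i\<in>UNIV. \<Sum>t\<in>UNIV. Pt i t (q' i $ t) - Pt i t (q i $ t))"
    by (rule sum.swap)
  \<comment> \<open>The vector \<open>y\<close> in \<open>P\<close> is arbitrary;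
    \<open>period q t\<close> is chosen because the equilibrium conditions hold the others at
    \<open>q\<close>.\<close>
  also have "\<dots> = (\<Sum>i\<in>UNIV. \<Sum>t\<in>UNIV. P i t (replace (period q t) i (q' i $ t))
      - P i t (replace (period q t) i (q i $ t)))"
    by (simp only: P)
  finally show ?thesis
    by (simp add: system_welfare_def producer_profit_def sum_subtractf sum.distrib algebra_simps)
qed

lemma system_optimal_imp_uc_nash_equilibrium:
  fixes P :: "'i::finite \<Rightarrow> 't::finite \<Rightarrow> real^'i \<Rightarrow> real"
  assumes pot: "\<And>i t y x. F t y - F t (replace y i x) = P i t y - P i t (replace y i x)"
    and opt: "system_optimal F C S G H h A b q u"
  shows "uc_nash_equilibrium P C S G H h A b q u"
proof -
  have feas: "\<forall>i. unit_feasible (G i) (H i) (h i) (A i) (b i) (q i) (u i)"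
    using opt by (simp add: system_optimal_def is_arg_max_linorder)
  have max: "system_welfare F C S q' u' \<le> system_welfare F C S q u"
    if "\<forall>i. unit_feasible (G i) (H i) (h i) (A i) (b i) (q' i) (u' i)" for q' u'
    using opt that by (simp add: system_optimal_def is_arg_max_linorder)
  have "producer_profit P C S i q x v \<le> producer_profit P C S i q (q i) (u i)"
    if "unit_feasible (G i) (H i) (h i) (A i) (b i) x v" for i x v
  proof -
    \<comment> \<open>No constraint couples different producers, so changing one schedule to a
      feasible one keeps the whole profile feasible.\<close>
    have "system_welfare F C S (q(i := x)) (u(i := v)) \<le> system_welfare F C S q u"
      using feas that by (intro max) simp
    then show ?thesis
      using system_welfare_unilateral_diff [of F P C S q i x u v, OF pot] by simp
  qed
  with feas show ?thesis
    by (simp add: uc_nash_equilibrium_def is_arg_max_linorder)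
qed

lemma uc_nash_equilibrium_imp_system_optimal:
  fixes P :: "'i::finite \<Rightarrow> 't::finite \<Rightarrow> real^'i \<Rightarrow> real"
  assumes P: "\<And>i t y x x'. P i t (replace y i x) - P i t (replace y i x') = Pt i t x - Pt i t x'"
    and F: "\<And>t y x. F t y - F t x = (\<Sum>i\<in>UNIV. Pt i t (y $ i) - Pt i t (x $ i))"
    and nash: "uc_nash_equilibrium P C S G H h A b q u"
  shows "system_optimal F C S G H h A b q u"
proof -
  have feas: "\<forall>i. unit_feasible (G i) (H i) (h i) (A i) (b i) (q i) (u i)"
    using nash by (simp add: uc_nash_equilibrium_def is_arg_max_linorder)
  have max: "producer_profit P C S i q x v \<le> producer_profit P C S i q (q i) (u i)"
    if "unit_feasible (G i) (H i) (h i) (A i) (b i) x v" for i x v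
    using nash that by (simp add: uc_nash_equilibrium_def is_arg_max_linorder)
  have "system_welfare F C S q' u' \<le> system_welfare F C S q u"
    if "\<forall>i. unit_feasible (G i) (H i) (h i) (A i) (b i) (q' i) (u' i)" for q' u'
  proof -
    \<comment> \<open>Each component of a feasible profile is an admissible unilateral deviation
      from \<open>q\<close>, \<open>u\<close>, so every summand is nonpositive.\<close>
    have "(\<Sum>i\<in>UNIV. producer_profit P C S i q (q' i) (u' i)
        - producer_profit P C S i q (q i) (u i)) \<le> 0"
      using max that by (intro sum_nonpos) simp
    then show ?thesis
      using system_welfare_separable_diff [of P Pt F C S q' u' q u, OF P F] by simp
  qed
  with feas show ?thesis
    by (simp add: system_optimal_def is_arg_max_linorder)
qed

theorem proposition4:
  fixes P :: "'i::finite \<Rightarrow> 't::finite \<Rightarrow> real^'i \<Rightarrow> real"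
    and F :: "'t \<Rightarrow> real^'i \<Rightarrow> real"
    and C :: "'i \<Rightarrow> real \<Rightarrow> real"
    and S :: "'i \<Rightarrow> real^'t \<Rightarrow> real"
    and G H :: "'i \<Rightarrow> real^'t^'m::finite"
    and h :: "'i \<Rightarrow> real^'m"
    and A :: "'i \<Rightarrow> real^'t^'n::finite"
    and b :: "'i \<Rightarrow> real^'n"
  assumes "\<And>i t y. concave_on UNIV (\<lambda>x. P i t (replace y i x))"
    and "\<And>i t y. (\<lambda>x. P i t (replace y i x)) C1_differentiable_on UNIV"
    and "\<And>i. convex_on UNIV (C i)"
    and "\<And>i. C i C1_differentiable_on UNIV"
    and "\<And>i. continuous_on UNIV (S i)"
    and "\<And>t. concave_on UNIV (F t)"
    and "\<And>t. continuously_differentiable (F t)"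
  shows "((\<forall>i t y x. F t y - F t (replace y i x) = P i t y - P i t (replace y i x)) \<longrightarrow>
            (\<forall>q u. system_optimal F C S G H h A b q u \<longrightarrow>
                    uc_nash_equilibrium P C S G H h A b q u)) \<and>
         (\<forall>Pt :: 'i \<Rightarrow> 't \<Rightarrow> real \<Rightarrow> real.
            (\<forall>i t y x x'. P i t (replace y i x) - P i t (replace y i x') = Pt i t x - Pt i t x') \<longrightarrow>
            (\<forall>t y x. F t y - F t x = (\<Sum>i\<in>UNIV. Pt i t (y $ i) - Pt i t (x $ i))) \<longrightarrow>
            (\<forall>q u. uc_nash_equilibrium P C S G H h A b q u \<longrightarrow>
                    system_optimal F C S G H h A b q u))"
proof (intro conjI allI impI, goal_cases)
  case (1 q u)
  show ?case
    by (rule system_optimal_imp_uc_nash_equilibrium [OF _ 1(2)]) (use 1(1) in simp)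
next
  case (2 Pt q u)
  show ?case
    by (rule uc_nash_equilibrium_imp_system_optimal [where Pt = Pt, OF _ _ 2(3)])
      (rule 2(1) [rule_format], rule 2(2) [rule_format])
qed

end
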